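(* Let $\gamma>0$ and let $\sigma\in\mathbb{R}$ not be a negative integer ($\sigma\neq -1,-2,-3,\dots$). For $z\in\mathbb{C}$ consider the state $$|z,\gamma,\sigma\rangle=\left(\mathcal{N}_{\gamma,\sigma}(z\bar z)\right)^{-1/2}\sum_{n=0}^{\infty}\sqrt{\frac{n!}{(2\gamma)_n}}\,\frac{\bar z^{\,n}}{(\sigma+1)_n}\,|\psi_n\rangle ,$$ where $\{|\psi_n\rangle\}_{n\ge 0}$ is an orthonormal basis of a separable infinite-dimensional complex Hilbert space $\mathcal{H}$ and $\mathcal{N}_{\gamma,\sigma}(z\bar z)$ is the normalization factor, determined by $\langle z,\gamma,\sigma|z,\gamma,\sigma\rangle=1$. Then, for all $z\in\mathbb{C}$, $$\mathcal{N}_{\gamma,\sigma}(z\bar z)={}_{2}F_{3}\left(\begin{array}{c}1,1\\ 2\gamma,\sigma+1,\sigma+1\end{array}\Big\vert\, z\bar z\right).$$ In particular: (i) when $\gamma=1/2$ and $\sigma\in\{1,2,3,\dots\}$, this reduces to $$\mathcal{N}_{\frac12,\sigma}(z\bar z)=\left[I_0(2|z|)-\sum_{n=0}^{\sigma-1}\frac{|z|^{2n}}{(n!)^2}\right]\frac{\Gamma^2(\sigma+1)}{|z|^{2\sigma}};$$ (ii) when $\sigma=0$, it reads $$\mathcal{N}_{\gamma,0}(z\bar z)=\Gamma(2\gamma)\,|z|^{1-2\gamma}\,I_{2\gamma-1}(2|z|).$$ At $z=0$ the right-hand sides of (i) and (ii) are understood by continuous extension.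
   Context: $(a)_0=1$, $(a)_n=a(a+1)\cdots(a+n-1)$ is the Pochhammer symbol. ${}_{2}F_{3}\left(\begin{array}{c}a_1,a_2\\ b_1,b_2,b_3\end{array}\Big\vert x\right)=\sum_{n\ge0}\frac{(a_1)_n(a_2)_n}{(b_1)_n(b_2)_n(b_3)_n}\frac{x^n}{n!}$. $I_\tau(x)=\sum_{k\ge 0}\frac{(x/2)^{2k+\tau}}{k!\,\Gamma(k+\tau+1)}$ is the modified Bessel function of the first kind of order $\tau$. *)

theory Defs
  imports "HOL-Analysis.Analysis"
begin

(* The inner product is conjugate-linear in its first argument, as for bra-kets.
   Completeness comes from banach. *)
class complex_hilbert_space = banach +
  fixes scaleC :: "complex \<Rightarrow> 'a \<Rightarrow> 'a"  (infixr "*\<^sub>C" 75)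
    and cinner :: "'a \<Rightarrow> 'a \<Rightarrow> complex"
  assumes scaleC_add_right: "c *\<^sub>C (x + y) = c *\<^sub>C x + c *\<^sub>C y"
    and scaleC_add_left: "(c + d) *\<^sub>C x = c *\<^sub>C x + d *\<^sub>C x"
    and scaleC_scaleC: "c *\<^sub>C d *\<^sub>C x = (c * d) *\<^sub>C x"
    and scaleC_one: "1 *\<^sub>C x = x"
    and scaleR_scaleC: "r *\<^sub>R x = complex_of_real r *\<^sub>C x"
    and cinner_commute: "cinner x y = cnj (cinner y x)"
    and cinner_add_right: "cinner x (y + z) = cinner x y + cinner x z"
    and cinner_scaleC_right: "cinner x (c *\<^sub>C y) = c * cinner x y"
    and cinner_self: "cinner x x = complex_of_real ((norm x)\<^sup>2)"

interpretation complex_vector: vector_space "scaleC :: complex \<Rightarrow> 'a \<Rightarrow> 'a::complex_hilbert_space"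
  by unfold_locales (simp_all add: scaleC_add_right scaleC_add_left scaleC_scaleC scaleC_one)

definition orthonormal_basis :: "(nat \<Rightarrow> 'a::complex_hilbert_space) \<Rightarrow> bool" where
  "orthonormal_basis \<psi> \<longleftrightarrow>
     (\<forall>m n. cinner (\<psi> m) (\<psi> n) = (if m = n then 1 else 0)) \<and>
     closure (complex_vector.span (range \<psi>)) = UNIV"

definition hypergeom_2F3 :: "'a \<Rightarrow> 'a \<Rightarrow> 'a \<Rightarrow> 'a \<Rightarrow> 'a \<Rightarrow> 'a \<Rightarrow> 'a::{banach, real_normed_field}" where
  "hypergeom_2F3 a1 a2 b1 b2 b3 x =
     (\<Sum>n. (pochhammer a1 n * pochhammer a2 n) /
          (pochhammer b1 n * pochhammer b2 n * pochhammer b3 n) * (x ^ n / fact n))"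

(* For real order and x \<ge> 0. The case distinction is the convention 0^0 = 1, since
   0 powr 0 = 0. At the poles of Gamma, division by Gamma = 0 gives 1/Gamma = 0. *)
definition bessel_I :: "real \<Rightarrow> real \<Rightarrow> real" where
  "bessel_I \<tau> x =
     (\<Sum>k. (if 2 * real k + \<tau> = 0 then 1 else (x / 2) powr (2 * real k + \<tau>)) /
          (fact k * Gamma (real k + \<tau> + 1)))"

definition state_term :: "(nat \<Rightarrow> 'a::complex_hilbert_space) \<Rightarrow> real \<Rightarrow> real \<Rightarrow> complex \<Rightarrow> nat \<Rightarrow> 'a" where
  "state_term \<psi> \<gamma> \<sigma> z n =
     (complex_of_real (sqrt (fact n / pochhammer (2 * \<gamma>) n)) *
       (cnj z ^ n / complex_of_real (pochhammer (\<sigma> + 1) n))) *\<^sub>C \<psi> n"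

definition state_with_factor ::
    "real \<Rightarrow> (nat \<Rightarrow> 'a::complex_hilbert_space) \<Rightarrow> real \<Rightarrow> real \<Rightarrow> complex \<Rightarrow> 'a" where
  "state_with_factor N \<psi> \<gamma> \<sigma> z =
     complex_of_real (N powr (- 1 / 2)) *\<^sub>C (\<Sum>n. state_term \<psi> \<gamma> \<sigma> z n)"

definition normalizes ::
    "real \<Rightarrow> (nat \<Rightarrow> 'a::complex_hilbert_space) \<Rightarrow> real \<Rightarrow> real \<Rightarrow> complex \<Rightarrow> bool" where
  "normalizes N \<psi> \<gamma> \<sigma> z \<longleftrightarrow>
     N > 0 \<and> cinner (state_with_factor N \<psi> \<gamma> \<sigma> z) (state_with_factor N \<psi> \<gamma> \<sigma> z) = 1"

definition normalization_factor ::
    "(nat \<Rightarrow> 'a::complex_hilbert_space) \<Rightarrow> real \<Rightarrow> real \<Rightarrow> complex \<Rightarrow> real" where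
  "normalization_factor \<psi> \<gamma> \<sigma> z = (THE N. normalizes N \<psi> \<gamma> \<sigma> z)"

end

theory Submission
  imports Defs "HOL-Real_Asymp.Real_Asymp"
begin

text \<open>By orthonormality the unnormalized state has squared norm equal to the power series in
  \<open>x = z * cnj z\<close> with coefficients \<open>n! / ((2 \<gamma>)\<^sub>n ((\<sigma> + 1)\<^sub>n)\<^sup>2)\<close>. The ratio of consecutive
  coefficients tends to 0, so this series is entire, with value 1 at 0; it is the hypergeometric
  series because \<open>(1)\<^sub>n = n!\<close>. For integer \<open>\<sigma>\<close> and \<open>\<gamma> = 1/2\<close> the coefficients are shifted Bessel
  coefficients, for \<open>\<sigma> = 0\<close> they are the Bessel coefficients of order \<open>2 \<gamma> - 1\<close>. The continuous
  extension to \<open>z = 0\<close> is the continuity of the series.\<close>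

section \<open>Inner product and orthogonal series\<close>

lemma cinner_scaleC_left:
  fixes x y :: "'a::complex_hilbert_space"
  shows "cinner (c *\<^sub>C x) y = cnj c * cinner x y"
  by (metis cinner_commute cinner_scaleC_right complex_cnj_mult)

lemma cinner_zero_right:
  fixes x :: "'a::complex_hilbert_space"
  shows "cinner x 0 = 0"
  using cinner_add_right[of x 0 0] by simp

lemma cinner_sum_right:
  fixes x :: "'a::complex_hilbert_space"
  shows "cinner x (\<Sum>i\<in>A. f i) = (\<Sum>i\<in>A. cinner x (f i))"
  by (induction A rule: infinite_finite_induct) (simp_all add: cinner_zero_right cinner_add_right)

lemma norm_scaleC:
  fixes x :: "'a::complex_hilbert_space"
  shows "norm (c *\<^sub>C x) = cmod c * norm x"
proof -
  have "complex_of_real ((norm (c *\<^sub>C x))\<^sup>2) = complex_of_real ((cmod c * norm x)\<^sup>2)"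
    unfolding cinner_self[symmetric] cinner_scaleC_left cinner_scaleC_right
    by (simp add: cinner_self power_mult_distrib flip: complex_norm_square)
  then have "(norm (c *\<^sub>C x))\<^sup>2 = (cmod c * norm x)\<^sup>2"
    by (simp only: of_real_eq_iff)
  then show ?thesis
    by (simp add: power2_eq_iff_nonneg)
qed

lemma norm_add_orthogonal:
  fixes x y :: "'a::complex_hilbert_space"
  assumes "cinner y x = 0"
  shows "(norm (x + y))\<^sup>2 = (norm x)\<^sup>2 + (norm y)\<^sup>2"
proof -
  have xy: "cinner x y = 0"
    using assms cinner_commute[of x y] by simp
  \<comment> \<open>Additivity in the first argument is inherited from the second by conjugate
    symmetry.\<close>
  have "cinner (x + y) x = cnj (cinner x x + cinner x y)"
    "cinner (x + y) y = cnj (cinner y x + cinner y y)"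
    by (metis cinner_commute cinner_add_right)+
  then have "cinner (x + y) (x + y) = complex_of_real ((norm x)\<^sup>2 + (norm y)\<^sup>2)"
    unfolding cinner_add_right[of "x + y"] by (simp add: cinner_add_right xy assms cinner_self)
  then show ?thesis
    unfolding cinner_self by (simp only: of_real_eq_iff)
qed

lemma norm_sum_orthogonal:
  fixes v :: "nat \<Rightarrow> 'a::complex_hilbert_space"
  assumes "\<And>m n. m \<noteq> n \<Longrightarrow> cinner (v m) (v n) = 0"
  shows "(norm (\<Sum>n<k. v n))\<^sup>2 = (\<Sum>n<k. (norm (v n))\<^sup>2)"
proof (induction k)
  case (Suc k)
  have "cinner (v k) (\<Sum>n<k. v n) = 0"
    unfolding cinner_sum_right by (rule sum.neutral) (auto intro: assms)
  then show ?case
    using Suc by (simp add: norm_add_orthogonal)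
qed simp

text \<open>The finite Pythagorean identity passes to the limit by continuity of the norm, which
  also yields convergence of the squared norms.\<close>

lemma sums_norm_orthogonal:
  fixes v :: "nat \<Rightarrow> 'a::complex_hilbert_space"
  assumes "\<And>m n. m \<noteq> n \<Longrightarrow> cinner (v m) (v n) = 0" and "summable v"
  shows "(\<lambda>n. (norm (v n))\<^sup>2) sums (norm (\<Sum>n. v n))\<^sup>2"
proof -
  have "(\<lambda>k. (norm (\<Sum>n<k. v n))\<^sup>2) \<longlonglongrightarrow> (norm (\<Sum>n. v n))\<^sup>2"
    using assms(2) by (intro tendsto_intros summable_LIMSEQ)
  moreover have "(norm (\<Sum>n<k. v n))\<^sup>2 = (\<Sum>n<k. (norm (v n))\<^sup>2)" for k
    by (rule norm_sum_orthogonal) (rule assms(1))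
  ultimately show ?thesis
    by (simp add: sums_def)
qed

section \<open>The power series of the squared norm\<close>

text \<open>These are the squared moduli of the coefficients of the state, stripped of the power of
  \<open>z\<close>.\<close>

definition norm_coeff :: "real \<Rightarrow> real \<Rightarrow> nat \<Rightarrow> real" where
  "norm_coeff \<gamma> \<sigma> n = fact n / (pochhammer (2 * \<gamma>) n * (pochhammer (\<sigma> + 1) n)\<^sup>2)"

definition norm_series :: "real \<Rightarrow> real \<Rightarrow> real \<Rightarrow> real" where
  "norm_series \<gamma> \<sigma> x = (\<Sum>n. norm_coeff \<gamma> \<sigma> n * x ^ n)"

lemma pochhammer_succ_nonzero:
  fixes \<sigma> :: real
  assumes "\<forall>k::nat. k \<ge> 1 \<longrightarrow> \<sigma> \<noteq> - real k"
  shows "pochhammer (\<sigma> + 1) n \<noteq> 0"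
proof
  assume "pochhammer (\<sigma> + 1) n = 0"
  then obtain k where "\<sigma> + 1 = - real k"
    by (auto simp: pochhammer_eq_0_iff)
  then have "\<sigma> = - real (Suc k)"
    by simp
  then show False
    using assms by (metis le_add1 plus_1_eq_Suc)
qed

context
  fixes \<gamma> \<sigma> :: real
  assumes \<gamma>: "\<gamma> > 0" and \<sigma>: "\<forall>k::nat. k \<ge> 1 \<longrightarrow> \<sigma> \<noteq> - real k"
begin

text \<open>The factor \<open>pochhammer (\<sigma> + 1) n\<close> may be negative, but it is nonzero
  and enters squared.\<close>

lemma norm_coeff_pos: "norm_coeff \<gamma> \<sigma> n > 0"
  unfolding norm_coeff_def
  using \<gamma> pochhammer_succ_nonzero[OF \<sigma>] by (simp add: pochhammer_pos)

lemma norm_coeff_Suc: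
  "norm_coeff \<gamma> \<sigma> (Suc n) =
    norm_coeff \<gamma> \<sigma> n * ((real n + 1) / ((2 * \<gamma> + real n) * (\<sigma> + 1 + real n)\<^sup>2))"
  by (simp add: norm_coeff_def pochhammer_Suc power_mult_distrib mult_ac add_ac)

lemma summable_norm_coeff: "summable (\<lambda>n. norm_coeff \<gamma> \<sigma> n * x ^ n)"
proof -
  \<comment> \<open>The absolute ratio of consecutive terms, of order |x| / n^2.\<close>
  define q where "q = (\<lambda>n. (real n + 1) / ((2 * \<gamma> + real n) * (\<sigma> + 1 + real n)\<^sup>2) * \<bar>x\<bar>)"
  have "q \<longlonglongrightarrow> 0"
    unfolding q_def by real_asymp
  then have "\<forall>\<^sub>F n in sequentially. q n < 1 / 2"
    by (rule order_tendstoD) simp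
  then obtain N where N: "q n < 1 / 2" if "n \<ge> N" for n
    by (auto simp: eventually_sequentially)
  show ?thesis
  proof (rule summable_ratio_test[of "1/2" N])
    fix n assume "n \<ge> N"
    have "norm (norm_coeff \<gamma> \<sigma> (Suc n) * x ^ Suc n) = q n * norm (norm_coeff \<gamma> \<sigma> n * x ^ n)"
      using \<gamma> by (simp add: norm_coeff_Suc q_def abs_mult)
    also have "\<dots> \<le> 1 / 2 * norm (norm_coeff \<gamma> \<sigma> n * x ^ n)"
      using N[OF \<open>n \<ge> N\<close>] by (intro mult_right_mono) auto
    finally show "norm (norm_coeff \<gamma> \<sigma> (Suc n) * x ^ Suc n)
        \<le> 1 / 2 * norm (norm_coeff \<gamma> \<sigma> n * x ^ n)" .
  qed simp
qed

lemma norm_series_sums: "(\<lambda>n. norm_coeff \<gamma> \<sigma> n * x ^ n) sums norm_series \<gamma> \<sigma> x"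
  unfolding norm_series_def by (rule summable_sums) (rule summable_norm_coeff)

lemma isCont_norm_series: "isCont (norm_series \<gamma> \<sigma>) x"
proof -
  have "isCont (\<lambda>x. \<Sum>n. norm_coeff \<gamma> \<sigma> n * x ^ n) x"
    \<comment> \<open>Continuity at \<open>x\<close> needs convergence at some point of larger
      modulus; |x| + 1 serves.\<close>
    by (rule isCont_powser[OF summable_norm_coeff[of "\<bar>x\<bar> + 1"]]) simp
  then show ?thesis
    by (simp add: norm_series_def[abs_def])
qed

text \<open>All terms are nonnegative and the constant term is positive.\<close>

lemma norm_series_pos:
  assumes "x \<ge> 0"
  shows "norm_series \<gamma> \<sigma> x > 0"
proof -
  have "0 < norm_coeff \<gamma> \<sigma> 0 * x ^ 0"
    using norm_coeff_pos by simp
  also have "\<dots> \<le> norm_series \<gamma> \<sigma> x"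
    unfolding norm_series_def
    using sum_le_suminf[OF summable_norm_coeff, of "{0}" x] assms norm_coeff_pos
    by (auto simp: less_imp_le)
  finally show ?thesis .
qed

text \<open>One of the two factors (1)_n = n! cancels the n! of the exponential weight, leaving the
  n! in the numerator of \<open>norm_coeff\<close>.\<close>

lemma norm_series_hypergeom:
  "hypergeom_2F3 1 1 (complex_of_real (2 * \<gamma>)) (complex_of_real (\<sigma> + 1))
     (complex_of_real (\<sigma> + 1)) (complex_of_real x) = complex_of_real (norm_series \<gamma> \<sigma> x)"
proof -
  have "(pochhammer 1 n * pochhammer 1 n) /
      (pochhammer (complex_of_real (2 * \<gamma>)) n * pochhammer (complex_of_real (\<sigma> + 1)) n *
       pochhammer (complex_of_real (\<sigma> + 1)) n) * (complex_of_real x ^ n / fact n) =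
      complex_of_real (norm_coeff \<gamma> \<sigma> n * x ^ n)" for n
    unfolding pochhammer_of_real
    by (simp add: norm_coeff_def power2_eq_square flip: pochhammer_fact)
  then show ?thesis
    unfolding hypergeom_2F3_def
    using sums_of_real[OF norm_series_sums, where 'a = complex] by (simp add: sums_iff)
qed

section \<open>Convergence and norm of the state\<close>

lemma norm_state_term:
  fixes \<psi> :: "nat \<Rightarrow> 'h::complex_hilbert_space"
  assumes "orthonormal_basis \<psi>"
  shows "(norm (state_term \<psi> \<gamma> \<sigma> z n))\<^sup>2 = norm_coeff \<gamma> \<sigma> n * ((cmod z)\<^sup>2) ^ n"
proof -
  have "complex_of_real ((norm (\<psi> n))\<^sup>2) = complex_of_real 1"
    using assms by (simp only: orthonormal_basis_def flip: cinner_self) simp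
  then have "norm (\<psi> n) = 1"
    by (metis norm_ge_zero of_real_eq_iff power2_eq_1_iff zero_le_one
        neg_0_le_iff_le not_one_le_zero)
  \<comment> \<open>Nonnegativity of the radicand lets the square undo the square root.\<close>
  moreover have "fact n / pochhammer (2 * \<gamma>) n \<ge> 0"
    using \<gamma> by (simp add: pochhammer_nonneg)
  ultimately show ?thesis
    by (simp add: state_term_def norm_scaleC norm_coeff_def norm_mult norm_divide norm_power
        power_mult_distrib power_divide mult.commute flip: power_mult)
qed

text \<open>Convergence is absolute: weighting the squared norms by 4^n only moves the argument of
  the entire series to 4 |z|^2, and a geometric series pays for passing from squared norms to
  norms.\<close>

lemma summable_state_term:
  fixes \<psi> :: "nat \<Rightarrow> 'h::complex_hilbert_space"
  assumes "orthonormal_basis \<psi>"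
  shows "summable (state_term \<psi> \<gamma> \<sigma> z)"
proof (rule summable_comparison_test')
  show "summable (\<lambda>n. norm_coeff \<gamma> \<sigma> n * (4 * (cmod z)\<^sup>2) ^ n + (1 / 4) ^ n)"
    by (intro summable_add summable_norm_coeff summable_geometric) simp
next
  fix n
  define a where "a = norm (state_term \<psi> \<gamma> \<sigma> z n)"
  \<comment> \<open>AM-GM: \<open>2 a \<le> 4^n a^2 + 4^(-n)\<close>\<close>
  have "0 \<le> (2 ^ n * a - (1 / 2) ^ n)\<^sup>2"
    by simp
  also have "\<dots> = 4 ^ n * a\<^sup>2 + (1 / 4) ^ n - 2 * a"
    by (simp add: power2_diff power_mult_distrib power_one_over flip: power_mult power_mult[of 2 2])
       (simp add: power_mult mult.commute[of n])
  finally have "2 * a \<le> 4 ^ n * a\<^sup>2 + (1 / 4) ^ n"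
    by simp
  moreover have "a \<ge> 0"
    by (simp add: a_def)
  ultimately have "a \<le> 4 ^ n * a\<^sup>2 + (1 / 4) ^ n"
    by linarith
  then show "norm (state_term \<psi> \<gamma> \<sigma> z n)
      \<le> norm_coeff \<gamma> \<sigma> n * (4 * (cmod z)\<^sup>2) ^ n + (1 / 4) ^ n"
    unfolding a_def norm_state_term[OF assms] power_mult_distrib[of 4] by (simp add: mult_ac)
qed

lemma norm_state:
  fixes \<psi> :: "nat \<Rightarrow> 'h::complex_hilbert_space"
  assumes "orthonormal_basis \<psi>"
  shows "(norm (\<Sum>n. state_term \<psi> \<gamma> \<sigma> z n))\<^sup>2 = norm_series \<gamma> \<sigma> ((cmod z)\<^sup>2)"
proof -
  have "cinner (state_term \<psi> \<gamma> \<sigma> z m) (state_term \<psi> \<gamma> \<sigma> z n) = 0" if "m \<noteq> n" for m n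
    using assms that
    by (simp add: state_term_def cinner_scaleC_left cinner_scaleC_right orthonormal_basis_def)
  from sums_norm_orthogonal[OF this summable_state_term[OF assms]] show ?thesis
    unfolding norm_state_term[OF assms] using norm_series_sums sums_unique2 by blast
qed

text \<open>The prefactor divides the squared norm by \<open>N\<close>, so the condition reads
  \<open>?F / N = 1\<close>; positivity of the series makes this solution admissible.\<close>

lemma normalizes_iff:
  fixes \<psi> :: "nat \<Rightarrow> 'h::complex_hilbert_space"
  assumes "orthonormal_basis \<psi>"
  shows "normalizes N \<psi> \<gamma> \<sigma> z \<longleftrightarrow> N = norm_series \<gamma> \<sigma> ((cmod z)\<^sup>2)"
proof -
  let ?F = "norm_series \<gamma> \<sigma> ((cmod z)\<^sup>2)"
  have F: "?F > 0"
    by (rule norm_series_pos) simp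
  have "cinner (state_with_factor N \<psi> \<gamma> \<sigma> z) (state_with_factor N \<psi> \<gamma> \<sigma> z) =
      complex_of_real (?F / N)" if "N > 0"
  proof -
    have "(N powr (- 1 / 2))\<^sup>2 = 1 / N"
      using that by (simp add: powr_minus_divide powr_half_sqrt power_divide)
    then show ?thesis
      by (simp add: cinner_self state_with_factor_def norm_scaleC power_mult_distrib
          norm_state[OF assms])
  qed
  then show ?thesis
    unfolding normalizes_def using F by (auto simp flip: of_real_divide)
qed

lemma normalization_factor_eq:
  fixes \<psi> :: "nat \<Rightarrow> 'h::complex_hilbert_space"
  assumes "orthonormal_basis \<psi>"
  shows "normalization_factor \<psi> \<gamma> \<sigma> z = norm_series \<gamma> \<sigma> ((cmod z)\<^sup>2)"
  unfolding normalization_factor_def normalizes_iff[OF assms] by simp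

text \<open>Serves both closed forms: a limit at 0 ignores the value there, so \<open>R\<close>
  inherits it from the continuous norm series.\<close>

lemma normalization_factor_tendsto:
  fixes \<psi> :: "nat \<Rightarrow> 'h::complex_hilbert_space"
  assumes "orthonormal_basis \<psi>" and "\<And>z. z \<noteq> 0 \<Longrightarrow> normalization_factor \<psi> \<gamma> \<sigma> z = R z"
  shows "(R \<longlongrightarrow> normalization_factor \<psi> \<gamma> \<sigma> 0) (at 0)"
proof -
  have "isCont (\<lambda>z::complex. norm_series \<gamma> \<sigma> ((cmod z)\<^sup>2)) 0"
    by (intro isCont_o2[OF _ isCont_norm_series] continuous_intros)
  then have "(normalization_factor \<psi> \<gamma> \<sigma> \<longlongrightarrow> normalization_factor \<psi> \<gamma> \<sigma> 0) (at 0)"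
    unfolding isCont_def normalization_factor_eq[OF assms(1), abs_def] .
  then show ?thesis
    by (rule Lim_transform_eventually) (auto simp: eventually_at_filter assms(2))
qed

end

section \<open>Reduction to Bessel functions\<close>

text \<open>Here the coefficient is (m!)^2 / ((n+m)!)^2, so up to a factor the series is the tail of
  the series of I_0(2r) from index m on.\<close>

lemma norm_series_half:
  assumes "r > 0"
  shows "norm_series (1 / 2) (real m) (r\<^sup>2) =
    (bessel_I 0 (2 * r) - (\<Sum>n<m. r ^ (2 * n) / (fact n)\<^sup>2)) *
    ((Gamma (real m + 1))\<^sup>2 / r ^ (2 * m))"
proof -
  define f where "f k = r ^ (2 * k) / (fact k)\<^sup>2" for k :: nat
  have bessel: "bessel_I 0 (2 * r) = (\<Sum>k. f k)"
    unfolding bessel_I_def f_def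
  proof (intro suminf_cong)
    fix k
    show "(if 2 * real k + 0 = 0 then 1 else (2 * r / 2) powr (2 * real k + 0)) /
        (fact k * Gamma (real k + 0 + 1)) = r ^ (2 * k) / (fact k)\<^sup>2"
      using assms powr_realpow[of r "2 * k"]
      by (simp add: Gamma_fact[symmetric] power2_eq_square add.commute)
  qed
  \<comment> \<open>Splitting (1)_{m+n} = (1)_m (m+1)_n.\<close>
  have poch: "pochhammer (real m + 1) n = fact (n + m) / fact m" for n
    using pochhammer_product'[of "1::real" m n]
    by (simp add: add_ac field_simps flip: pochhammer_fact)
  have shift: "f (n + m) = (r ^ (2 * m) / (fact m)\<^sup>2) * (norm_coeff (1 / 2) (real m) n * (r\<^sup>2) ^ n)" for n
    by (simp add: f_def norm_coeff_def poch power_divide power_add flip: pochhammer_fact power_mult)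
  have "(\<lambda>n. f (n + m)) sums ((r ^ (2 * m) / (fact m)\<^sup>2) * norm_series (1 / 2) (real m) (r\<^sup>2))"
    unfolding shift by (intro sums_mult norm_series_sums) auto
  then have "suminf f - (\<Sum>n<m. f n) = (r ^ (2 * m) / (fact m)\<^sup>2) * norm_series (1 / 2) (real m) (r\<^sup>2)"
    by (simp add: sums_iff_shift sums_iff)
  moreover have "Gamma (real m + 1) = fact m"
    using Gamma_fact[of m, where 'a = real] by (simp add: add.commute)
  ultimately show ?thesis
    using assms unfolding bessel f_def[symmetric] by (simp add: field_simps f_def[of m])
qed

text \<open>For \<sigma> = 0 the coefficient is 1 / (n! (2\<gamma>)_n), and (2\<gamma>)_n =
  Gamma(n+2\<gamma>) / Gamma(2\<gamma>) turns it into a Bessel coefficient.\<close>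

lemma norm_series_zero:
  assumes "\<gamma> > 0" and "r > 0"
  shows "norm_series \<gamma> 0 (r\<^sup>2) =
    Gamma (2 * \<gamma>) * r powr (1 - 2 * \<gamma>) * bessel_I (2 * \<gamma> - 1) (2 * r)"
proof -
  \<comment> \<open>The part of the Bessel terms that does not depend on \<open>k\<close>.\<close>
  define C where "C = r powr (2 * \<gamma> - 1) / Gamma (2 * \<gamma>)"
  have G: "Gamma (2 * \<gamma>) > 0"
    using assms by (simp add: Gamma_real_pos)
  have "(if 2 * real k + (2 * \<gamma> - 1) = 0 then 1
        else (2 * r / 2) powr (2 * real k + (2 * \<gamma> - 1))) /
      (fact k * Gamma (real k + (2 * \<gamma> - 1) + 1)) = C * (norm_coeff \<gamma> 0 k * (r\<^sup>2) ^ k)" for k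
  proof -
    \<comment> \<open>The exponent vanishes only for k = 0 and \<gamma> = 1/2; since
      \<open>r > 0\<close>, the default 1 then equals \<open>r powr 0\<close>.\<close>
    have "(if 2 * real k + (2 * \<gamma> - 1) = 0 then 1
        else (2 * r / 2) powr (2 * real k + (2 * \<gamma> - 1))) = r powr (2 * real k + (2 * \<gamma> - 1))"
      using assms by simp
    also have "\<dots> = (r\<^sup>2) ^ k * r powr (2 * \<gamma> - 1)"
      using assms powr_realpow[of r "2 * k"] by (simp add: powr_add power_mult)
    moreover have "2 * \<gamma> \<notin> \<int>\<^sub>\<le>\<^sub>0"
      using assms(1) nonpos_Ints_nonpos[of "2 * \<gamma>"] by linarith
    then have "Gamma (real k + (2 * \<gamma> - 1) + 1) = pochhammer (2 * \<gamma>) k * Gamma (2 * \<gamma>)"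
      using pochhammer_Gamma[of "2 * \<gamma>" k] G by (simp add: add_ac)
    ultimately show ?thesis
      by (simp add: C_def norm_coeff_def power2_eq_square mult_ac flip: pochhammer_fact)
  qed
  moreover have "(\<lambda>k. C * (norm_coeff \<gamma> 0 k * (r\<^sup>2) ^ k)) sums (C * norm_series \<gamma> 0 (r\<^sup>2))"
    using assms(1) by (intro sums_mult norm_series_sums) auto
  ultimately have "bessel_I (2 * \<gamma> - 1) (2 * r) = C * norm_series \<gamma> 0 (r\<^sup>2)"
    by (simp add: bessel_I_def sums_iff)
  moreover have "r powr (1 - 2 * \<gamma>) * r powr (2 * \<gamma> - 1) = 1"
    using assms by (simp flip: powr_add)
  ultimately show ?thesis
    using G by (simp add: C_def)
qed

text \<open>Summability and unique existence ensure that the infinite sum and the definite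
  description in the definitions denote the intended objects. The limits at 0 express the continuous
  extension.\<close>

theorem proposition3p1p1:
  fixes \<gamma> \<sigma> :: real and \<psi> :: "nat \<Rightarrow> 'h::complex_hilbert_space"
  assumes "\<gamma> > 0"
    and "\<forall>k::nat. k \<ge> 1 \<longrightarrow> \<sigma> \<noteq> - real k"
    and "orthonormal_basis \<psi>"
  shows "(\<forall>z. summable (state_term \<psi> \<gamma> \<sigma> z) \<and>
              (\<exists>!N. normalizes N \<psi> \<gamma> \<sigma> z) \<and>
              complex_of_real (normalization_factor \<psi> \<gamma> \<sigma> z) =
                hypergeom_2F3 1 1 (complex_of_real (2 * \<gamma>))
                  (complex_of_real (\<sigma> + 1)) (complex_of_real (\<sigma> + 1)) (z * cnj z)) \<and>
         (\<forall>m::nat. \<gamma> = 1 / 2 \<and> m \<ge> 1 \<and> \<sigma> = real m \<longrightarrow>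
            (let R = (\<lambda>z::complex.
                   (bessel_I 0 (2 * cmod z) - (\<Sum>n<m. cmod z ^ (2 * n) / (fact n)\<^sup>2)) *
                   ((Gamma (\<sigma> + 1))\<^sup>2 / cmod z ^ (2 * m)))
             in (\<forall>z. z \<noteq> 0 \<longrightarrow> normalization_factor \<psi> \<gamma> \<sigma> z = R z) \<and>
                (R \<longlongrightarrow> normalization_factor \<psi> \<gamma> \<sigma> 0) (at 0))) \<and>
         (\<sigma> = 0 \<longrightarrow>
            (let R = (\<lambda>z::complex.
                   Gamma (2 * \<gamma>) * cmod z powr (1 - 2 * \<gamma>) * bessel_I (2 * \<gamma> - 1) (2 * cmod z))
             in (\<forall>z. z \<noteq> 0 \<longrightarrow> normalization_factor \<psi> \<gamma> \<sigma> z = R z) \<and>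
                (R \<longlongrightarrow> normalization_factor \<psi> \<gamma> \<sigma> 0) (at 0)))"
proof (intro conjI allI impI)
  fix z
  show "summable (state_term \<psi> \<gamma> \<sigma> z)"
    by (rule summable_state_term[OF assms])
  show "\<exists>!N. normalizes N \<psi> \<gamma> \<sigma> z"
    unfolding normalizes_iff[OF assms] by simp
  show "complex_of_real (normalization_factor \<psi> \<gamma> \<sigma> z) =
      hypergeom_2F3 1 1 (complex_of_real (2 * \<gamma>))
        (complex_of_real (\<sigma> + 1)) (complex_of_real (\<sigma> + 1)) (z * cnj z)"
    \<comment> \<open>The argument \<open>z * cnj z\<close> becomes the embedded real |z|^2, as the
      hypergeometric lemma expects.\<close>
    unfolding normalization_factor_eq[OF assms] complex_norm_square[symmetric]
      norm_series_hypergeom[OF assms(1,2)] by (rule refl)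
next
  fix m :: nat
  assume "\<gamma> = 1 / 2 \<and> m \<ge> 1 \<and> \<sigma> = real m"
  then have \<gamma>: "\<gamma> = 1 / 2" and \<sigma>: "\<sigma> = real m"
    by blast+
  have "normalization_factor \<psi> \<gamma> \<sigma> z =
      (bessel_I 0 (2 * cmod z) - (\<Sum>n<m. cmod z ^ (2 * n) / (fact n)\<^sup>2)) *
      ((Gamma (\<sigma> + 1))\<^sup>2 / cmod z ^ (2 * m))" if "z \<noteq> 0" for z
    unfolding normalization_factor_eq[OF assms] unfolding \<gamma> \<sigma>
    by (rule norm_series_half) (use that in simp)
  with normalization_factor_tendsto[OF assms this]
  show "let R = (\<lambda>z::complex.
             (bessel_I 0 (2 * cmod z) - (\<Sum>n<m. cmod z ^ (2 * n) / (fact n)\<^sup>2)) *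
             ((Gamma (\<sigma> + 1))\<^sup>2 / cmod z ^ (2 * m)))
       in (\<forall>z. z \<noteq> 0 \<longrightarrow> normalization_factor \<psi> \<gamma> \<sigma> z = R z) \<and>
          (R \<longlongrightarrow> normalization_factor \<psi> \<gamma> \<sigma> 0) (at 0)"
    unfolding Let_def by blast
next
  assume \<sigma>: "\<sigma> = 0"
  have "normalization_factor \<psi> \<gamma> \<sigma> z =
      Gamma (2 * \<gamma>) * cmod z powr (1 - 2 * \<gamma>) * bessel_I (2 * \<gamma> - 1) (2 * cmod z)"
    if "z \<noteq> 0" for z
    unfolding normalization_factor_eq[OF assms]
    using \<sigma> that norm_series_zero[OF assms(1), of "cmod z"] by simp
  with normalization_factor_tendsto[OF assms this]
  show "let R = (\<lambda>z::complex.
             Gamma (2 * \<gamma>) * cmod z powr (1 - 2 * \<gamma>) * bessel_I (2 * \<gamma> - 1) (2 * cmod z))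
       in (\<forall>z. z \<noteq> 0 \<longrightarrow> normalization_factor \<psi> \<gamma> \<sigma> z = R z) \<and>
          (R \<longlongrightarrow> normalization_factor \<psi> \<gamma> \<sigma> 0) (at 0)"
    unfolding Let_def by blast
qed

end
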